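(* Consider the group presentations $\langle x,y,z\mid r^n\rangle$ where $n\ge 1$ is an integer and $r$ is one of the twelve words $$\begin{aligned} &x^2y^2z^2xzy, && x^2yxz^2y^2z,\\ &x^2yx^{-1}zyz^{-1}yz, && x^2yx^{-1}zyz^{-1}y^{-1}z,\\ &x^2yx^{-1}zy^{-1}zyz, && x^2yx^{-1}zy^{-1}z^{-1}yz,\\ &x^2yz^{-1}xy^{-1}zyz, && x^2yz^{-1}yzyx^{-1}z,\\ &x^2yz^{-1}yx^{-1}zyz, && x^2y^{-1}zxyzyz^{-1},\\ &x^2y^{-1}zyz^{-1}xyz, && x^2y^{-1}x^{-1}zyz^{-1}yz. \end{aligned}$$ Among these presentations exactly twelve define torsion-free groups, namely those with $n=1$.
   Context: A presentation defines a torsion-free group if the group it presents has no non-trivial element of finite order. *)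

theory Defs
  imports "HOL-Algebra.Coset"
begin

section \<open>Free groups\<close>

text \<open>The free group on a set is modelled by the freely reduced words in its letters, with
  concatenation followed by free reduction as product.\<close>

datatype 'a letter = Pos 'a | Neg 'a

fun base :: "'a letter \<Rightarrow> 'a" where
  "base (Pos a) = a"
| "base (Neg a) = a"

fun flip :: "'a letter \<Rightarrow> 'a letter" where
  "flip (Pos a) = Neg a"
| "flip (Neg a) = Pos a"

type_synonym 'a word = "'a letter list"

definition reduced :: "'a word \<Rightarrow> bool" where
  "reduced w \<longleftrightarrow> successively (\<lambda>a b. b \<noteq> flip a) w"

fun cancel_Cons :: "'a letter \<Rightarrow> 'a word \<Rightarrow> 'a word" where
  "cancel_Cons a [] = [a]"
| "cancel_Cons a (b # w) = (if b = flip a then w else a # b # w)"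

definition reduce :: "'a word \<Rightarrow> 'a word" where
  "reduce w = foldr cancel_Cons w []"

definition free_group :: "'a set \<Rightarrow> 'a word monoid" where
  "free_group S =
    \<lparr>carrier = {w. reduced w \<and> base ` set w \<subseteq> S},
     monoid.mult = (\<lambda>u v. reduce (u @ v)),
     one = []\<rparr>"

lemma flip_flip [simp]: "flip (flip a) = a"
  by (cases a) auto

lemma base_flip [simp]: "base (flip a) = base a"
  by (cases a) auto

lemma reduced_Nil [simp]: "reduced []"
  by (simp add: reduced_def)

lemma reduced_ConsD: "reduced (a # w) \<Longrightarrow> reduced w"
  by (cases w) (auto simp: reduced_def)

lemma reduced_cancel_Cons: "reduced w \<Longrightarrow> reduced (cancel_Cons a w)"
  by (cases w) (auto simp: reduced_def successively_Cons)

lemma cancel_Cons_reduced: "reduced (a # w) \<Longrightarrow> cancel_Cons a w = a # w"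
  by (cases w) (auto simp: reduced_def)

lemma cancel_Cons_flip: "reduced w \<Longrightarrow> cancel_Cons (flip a) (cancel_Cons a w) = w"
  by (cases w; cases "tl w") (auto simp: reduced_def)

lemma cancel_Cons_flip': "reduced w \<Longrightarrow> cancel_Cons a (cancel_Cons (flip a) w) = w"
  using cancel_Cons_flip[of w "flip a"] by simp

lemma reduced_foldr: "reduced v \<Longrightarrow> reduced (foldr cancel_Cons u v)"
  by (induction u) (auto intro: reduced_cancel_Cons)

lemma reduced_reduce: "reduced (reduce w)"
  by (simp add: reduce_def reduced_foldr)

lemma reduce_reduced: "reduced w \<Longrightarrow> reduce w = w"
  by (induction w) (auto simp: reduce_def cancel_Cons_reduced reduced_ConsD)

lemma foldr_cancel_Cons:
  assumes "reduced v"
  shows "foldr cancel_Cons (cancel_Cons a u) v = cancel_Cons a (foldr cancel_Cons u v)"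
  using assms by (cases u) (auto simp: cancel_Cons_flip' reduced_foldr)

lemma foldr_reduce:
  assumes "reduced v"
  shows "foldr cancel_Cons (reduce u) v = foldr cancel_Cons u v"
  by (induction u) (use assms in \<open>auto simp: reduce_def foldr_cancel_Cons\<close>)

lemma reduce_append: "reduce (u @ v) = foldr cancel_Cons u (reduce v)"
  by (simp add: reduce_def)

lemma reduce_append_left: "reduce (reduce u @ v) = reduce (u @ v)"
  by (simp add: reduce_append foldr_reduce reduced_reduce)

lemma reduce_append_right: "reduce (u @ reduce v) = reduce (u @ v)"
  by (simp add: reduce_append reduce_reduced reduced_reduce)

lemma reduce_flip_append: "reduce (rev (map flip w) @ w) = []"
proof (induction w)
  case (Cons a w)
  have "reduce (rev (map flip (a # w)) @ a # w)
      = foldr cancel_Cons (rev (map flip w)) (cancel_Cons (flip a) (cancel_Cons a (reduce w)))"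
    by (simp add: reduce_def)
  also have "\<dots> = []"
    using Cons by (simp add: cancel_Cons_flip reduced_reduce flip: reduce_append)
  finally show ?case .
qed (simp add: reduce_def)

lemma set_cancel_Cons: "set (cancel_Cons a w) \<subseteq> insert a (set w)"
  by (cases w) auto

lemma set_reduce: "set (reduce w) \<subseteq> set w"
proof (induction w)
  case (Cons a w)
  then show ?case
    using set_cancel_Cons[of a "reduce w"] by (auto simp: reduce_def)
qed (simp add: reduce_def)

lemma group_free_group: "group (free_group S)"
proof (rule groupI)
  fix u v w assume "u \<in> carrier (free_group S)" "v \<in> carrier (free_group S)"
    "w \<in> carrier (free_group S)"
  show "u \<otimes>\<^bsub>free_group S\<^esub> v \<otimes>\<^bsub>free_group S\<^esub> w
      = u \<otimes>\<^bsub>free_group S\<^esub> (v \<otimes>\<^bsub>free_group S\<^esub> w)"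
    by (simp add: free_group_def reduce_append_left reduce_append_right)
next
  fix u v assume "u \<in> carrier (free_group S)" "v \<in> carrier (free_group S)"
  then have "base ` set (u @ v) \<subseteq> S"
    by (auto simp: free_group_def)
  then show "u \<otimes>\<^bsub>free_group S\<^esub> v \<in> carrier (free_group S)"
    using set_reduce[of "u @ v"] by (auto simp: free_group_def reduced_reduce)
next
  fix w assume w: "w \<in> carrier (free_group S)"
  let ?v = "reduce (rev (map flip w))"
  have "?v \<in> carrier (free_group S)"
    using w set_reduce[of "rev (map flip w)"] by (fastforce simp: free_group_def reduced_reduce)
  moreover have "?v \<otimes>\<^bsub>free_group S\<^esub> w = \<one>\<^bsub>free_group S\<^esub>"
    by (simp add: free_group_def reduce_append_left reduce_flip_append)
  ultimately show "\<exists>v\<in>carrier (free_group S). v \<otimes>\<^bsub>free_group S\<^esub> w = \<one>\<^bsub>free_group S\<^esub>"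
    by blast
qed (auto simp: free_group_def reduce_reduced)

section \<open>Group presentations\<close>

definition normal_closure :: "('a, 'b) monoid_scheme \<Rightarrow> 'a set \<Rightarrow> 'a set" where
  "normal_closure G R = \<Inter> {N. N \<lhd> G \<and> R \<subseteq> N}"

lemma normal_normal_closure:
  assumes "group G" "R \<subseteq> carrier G"
  shows "normal_closure G R \<lhd> G"
proof -
  interpret group G by fact
  let ?A = "{N. N \<lhd> G \<and> R \<subseteq> N}"
  have ne: "carrier G \<in> ?A"
    using assms by (auto simp: normal_inv_iff subgroup_self)
  have "subgroup (\<Inter> ?A) G"
    using ne by (intro subgroups_Inter) (auto dest: normal_imp_subgroup)
  then show ?thesis
    unfolding normal_closure_def normal_inv_iff by (auto simp: normal_inv_iff)
qed

text \<open>A presentation is a set of generators together with a set of relators, which are elements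
  of the free group on the generators.\<close>

datatype 'a presentation = Presentation (generators: "'a set") (relators: "'a word set")

definition presented_group :: "'a presentation \<Rightarrow> 'a word set monoid" where
  "presented_group P = free_group (generators P) Mod
     normal_closure (free_group (generators P)) (relators P)"

lemma group_presented_group:
  assumes "relators P \<subseteq> carrier (free_group (generators P))"
  shows "group (presented_group P)"
  unfolding presented_group_def
  by (intro normal.factorgroup_is_group normal_normal_closure group_free_group assms)

definition torsion_free :: "('a, 'b) monoid_scheme \<Rightarrow> bool" where
  "torsion_free G \<longleftrightarrow>
    \<not> (\<exists>g\<in>carrier G. g \<noteq> \<one>\<^bsub>G\<^esub> \<and> (\<exists>k::nat. k > 0 \<and> g [^]\<^bsub>G\<^esub> k = \<one>\<^bsub>G\<^esub>))"

definition defines_torsion_free_group :: "'a presentation \<Rightarrow> bool" where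
  "defines_torsion_free_group P \<longleftrightarrow> torsion_free (presented_group P)"

section \<open>The twelve words\<close>

datatype xyz = GenX | GenY | GenZ

text \<open>A prime denotes the inverse of a generator.\<close>

definition twelve_words :: "xyz word set" where
  "twelve_words =
    (let x = Pos GenX; x' = Neg GenX; y = Pos GenY; y' = Neg GenY; z = Pos GenZ; z' = Neg GenZ in
     {[x,x,y,y,z,z,x,z,y],        [x,x,y,x,z,z,y,y,z],
      [x,x,y,x',z,y,z',y,z],      [x,x,y,x',z,y,z',y',z],
      [x,x,y,x',z,y',z,y,z],      [x,x,y,x',z,y',z',y,z],
      [x,x,y,z',x,y',z,y,z],      [x,x,y,z',y,z,y,x',z],
      [x,x,y,z',y,x',z,y,z],      [x,x,y',z,x,y,z,y,z'],
      [x,x,y',z,y,z',x,y,z],      [x,x,y',x',z,y,z',y,z]})"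

lemma twelve_words_carrier: "twelve_words \<subseteq> carrier (free_group {GenX, GenY, GenZ})"
  by (simp add: twelve_words_def Let_def free_group_def reduced_def)

definition power_presentation :: "xyz word \<Rightarrow> nat \<Rightarrow> xyz presentation" where
  "power_presentation r n =
    Presentation {GenX, GenY, GenZ} {r [^]\<^bsub>free_group {GenX, GenY, GenZ}\<^esub> n}"

end

theory Submission
  imports Defs "HOL-Algebra.Elementary_Groups"
begin

text \<open>
  Everything follows from one property of the twelve words. Give each generator \<open>b\<close> an integer weight
  \<open>\<chi> b\<close> such that the relator \<open>r\<close> has total weight \<open>0\<close>, and read \<open>r\<close> as a closed walk whose height
  changes by \<open>\<plusminus>\<chi> b\<close> along an edge labelled \<open>b\<close>. For each of the words the weights \<open>(1, -1, 0)\<close>,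
  \<open>(1, 0, -1)\<close> or \<open>(0, 1, -1)\<close> make the walk reach its highest edge with some label \<open>a\<close> only once
  (\<open>twelve_words_unique_peak\<close>). Under this hypothesis \<open>\<langle>S | r\<^sup>k\<rangle>\<close> is torsion-free for \<open>k = 1\<close> and has
  torsion for \<open>k \<ge> 2\<close>.

  The reason is a variant of the argument of Magnus. Remember with every letter the height of its
  edge: a word over \<open>S\<close> read from height \<open>n\<close> becomes a word over \<open>S \<times> \<int>\<close> (\<open>track\<close>), and a word of
  weight \<open>0\<close> may be evaluated, for each \<open>n\<close>, in any group \<open>H\<close> in which the letters \<open>(b, j)\<close> are given
  values. When the peak is unique, the equation that the copy of \<open>r\<close> at height \<open>n\<close> should take a given
  value \<open>c\<close> contains its topmost letter \<open>(a, j)\<close> just once, so it determines the value of \<open>(a, j)\<close> from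
  values at lower heights. Starting with arbitrary values at negative heights, the equations at all
  large \<open>n\<close> are solved recursively (\<open>relator_solvable\<close>).

  For \<open>k = 1\<close>, take for \<open>H\<close> the free group on \<open>S \<times> \<int>\<close> and \<open>c = 1\<close>. The words of weight \<open>0\<close> that take the
  value \<open>1\<close> at all sufficiently large heights form a normal subgroup (\<open>normal_track_preimage\<close>), so it
  contains the normal closure \<open>N\<close> of \<open>r\<close>. Conversely, forgetting heights maps \<open>H\<close> to the presented
  group, and by uniqueness of the solutions it maps the value of a word back to the class of the
  word. Hence a word of weight \<open>0\<close> lies in \<open>N\<close> as soon as its value at one height is \<open>1\<close>. If
  \<open>u\<^sup>k \<in> N\<close>, then \<open>u\<close> has weight \<open>0\<close> and the \<open>k\<close>-th power of its value at large heights is \<open>1\<close>; as free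
  groups are torsion-free, the value itself is \<open>1\<close> and \<open>u \<in> N\<close>.

  For \<open>k \<ge> 2\<close>, take \<open>H = \<int>\<close> and \<open>c = 1\<close>. Then \<open>r\<^sup>k\<close> takes the value \<open>k\<close> at all large heights, so every
  element of its normal closure eventually takes values divisible by \<open>k\<close>. The word \<open>r\<close> takes the
  value \<open>1\<close>, so it represents a non-trivial element of finite order.
\<close>

section \<open>Evaluating words in a group\<close>

fun eval_letter :: "('g, 'm) monoid_scheme \<Rightarrow> ('a \<Rightarrow> 'g) \<Rightarrow> 'a letter \<Rightarrow> 'g" where
  "eval_letter G g (Pos a) = g a"
| "eval_letter G g (Neg a) = inv\<^bsub>G\<^esub> (g a)"

definition eval_word :: "('g, 'm) monoid_scheme \<Rightarrow> ('a \<Rightarrow> 'g) \<Rightarrow> 'a word \<Rightarrow> 'g" where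
  "eval_word G g w = foldr (\<lambda>l x. eval_letter G g l \<otimes>\<^bsub>G\<^esub> x) w \<one>\<^bsub>G\<^esub>"

lemma eval_word_Nil [simp]: "eval_word G g [] = \<one>\<^bsub>G\<^esub>"
  by (simp add: eval_word_def)

lemma eval_word_Cons [simp]:
  "eval_word G g (l # w) = eval_letter G g l \<otimes>\<^bsub>G\<^esub> eval_word G g w"
  by (simp add: eval_word_def)

lemma eval_letter_cong: "g (base l) = g' (base l) \<Longrightarrow> eval_letter G g l = eval_letter G g' l"
  by (cases l) auto

lemma eval_word_cong:
  "(\<And>b. b \<in> base ` set w \<Longrightarrow> g b = g' b) \<Longrightarrow> eval_word G g w = eval_word G g' w"
  by (induction w) (auto intro: arg_cong2[where f = "mult G"] eval_letter_cong)

context group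
begin

lemma eval_letter_closed [simp]: "range g \<subseteq> carrier G \<Longrightarrow> eval_letter G g l \<in> carrier G"
  by (cases l) auto

lemma eval_word_closed [simp]: "range g \<subseteq> carrier G \<Longrightarrow> eval_word G g w \<in> carrier G"
  by (induction w) auto

lemma eval_word_append:
  "range g \<subseteq> carrier G \<Longrightarrow> eval_word G g (u @ v) = eval_word G g u \<otimes> eval_word G g v"
  by (induction u) (auto simp: m_assoc)

lemma eval_letter_flip:
  "range g \<subseteq> carrier G \<Longrightarrow> eval_letter G g (flip l) = inv (eval_letter G g l)"
  by (cases l) (auto simp: image_subset_iff)

lemma eval_word_cancel_Cons:
  assumes "range g \<subseteq> carrier G"
  shows "eval_word G g (cancel_Cons l w) = eval_letter G g l \<otimes> eval_word G g w"
  using assms by (cases w) (auto simp: eval_letter_flip simp flip: m_assoc)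

lemma eval_word_reduce: "range g \<subseteq> carrier G \<Longrightarrow> eval_word G g (reduce w) = eval_word G g w"
  by (induction w) (auto simp: reduce_def eval_word_cancel_Cons)

lemma eval_word_hom:
  "range g \<subseteq> carrier G \<Longrightarrow> eval_word G g \<in> hom (free_group S) G"
  by (auto simp: hom_def free_group_def eval_word_reduce eval_word_append)

text \<open>An equation in a group that contains an unknown exactly once, possibly inverted, has a solution,
  and by cancellation only one. Existence yields the values of the letters at the peaks; uniqueness
  identifies the images of these values in the presented group.\<close>

lemma eval_word_solvable:
  assumes g: "range g \<subseteq> carrier G" and c: "c \<in> carrier G" and fresh: "base l \<notin> base ` set (u @ v)"
  shows "\<exists>y\<in>carrier G. eval_word G (g(base l := y)) (u @ l # v) = c"
proof -
  let ?p = "eval_word G g u" and ?q = "eval_word G g v"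
  define e where "e = inv ?p \<otimes> c \<otimes> inv ?q"
  define y where "y = (case l of Pos _ \<Rightarrow> e | Neg _ \<Rightarrow> inv e)"
  have e: "e \<in> carrier G"
    using g c by (simp add: e_def)
  then have y: "y \<in> carrier G"
    by (simp add: y_def split: letter.split)
  have range: "range (g(base l := y)) \<subseteq> carrier G"
    using g y by auto
  have l: "eval_letter G (g(base l := y)) l = e"
    using e by (cases l) (auto simp: y_def)
  have "(g(base l := y)) b = g b" if "b \<in> base ` set (u @ v)" for b
    using that fresh by (cases "b = base l") simp_all
  then have "eval_word G (g(base l := y)) u = ?p" "eval_word G (g(base l := y)) v = ?q"
    by (auto intro!: eval_word_cong simp del: fun_upd_apply)
  then have "eval_word G (g(base l := y)) (u @ l # v) = ?p \<otimes> (e \<otimes> ?q)"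
    using eval_word_append[OF range] l by simp
  also have "\<dots> = c"
    using g c by (simp add: e_def m_assoc) (simp flip: m_assoc)
  finally show ?thesis
    using y by blast
qed

lemma eval_word_solution_unique:
  assumes g: "range g \<subseteq> carrier G" and g': "range g' \<subseteq> carrier G"
    and agree: "\<And>b. b \<in> base ` set (u @ v) \<Longrightarrow> g b = g' b"
    and eq: "eval_word G g (u @ l # v) = eval_word G g' (u @ l # v)"
  shows "g (base l) = g' (base l)"
proof -
  have u: "eval_word G g u = eval_word G g' u" and v: "eval_word G g v = eval_word G g' v"
    using agree by (auto intro!: eval_word_cong)
  have "eval_letter G g l = eval_letter G g' l"
    using eq g g' by (simp add: eval_word_append u v)
  then show ?thesis
    using g g' by (cases l) (auto simp: image_subset_iff dest: inv_inj[THEN inj_onD])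
qed

end

lemma eval_word_compose:
  assumes "group G" "group H" "\<eta> \<in> hom G H" "range g \<subseteq> carrier G"
  shows "\<eta> (eval_word G g w) = eval_word H (\<eta> \<circ> g) w"
proof -
  interpret group_hom G H \<eta>
    using assms by (simp add: group_hom_def group_hom_axioms_def)
  have "\<eta> (eval_letter G g l) = eval_letter H (\<eta> \<circ> g) l" for l
    using assms(4) by (cases l) (auto simp: image_subset_iff)
  then show ?thesis
    using assms(4) by (induction w) auto
qed

section \<open>Free groups are torsion-free\<close>

lemma carrier_free_group: "w \<in> carrier (free_group S) \<longleftrightarrow> reduced w \<and> base ` set w \<subseteq> S"
  by (simp add: free_group_def)

lemma mult_free_group [simp]: "u \<otimes>\<^bsub>free_group S\<^esub> v = reduce (u @ v)"
  by (simp add: free_group_def)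

lemma one_free_group [simp]: "\<one>\<^bsub>free_group S\<^esub> = []"
  by (simp add: free_group_def)

lemma nat_pow_free_group: "w [^]\<^bsub>free_group S\<^esub> (k :: nat) = reduce (concat (replicate k w))"
proof (induction k)
  case (Suc k)
  have "concat (replicate (Suc k) w) = concat (replicate k w) @ w"
    by (induction k) auto
  with Suc show ?case
    by (simp add: nat_pow_def reduce_append_left)
qed (simp add: nat_pow_def reduce_def)

lemma reduced_power:
  assumes "reduced w" "w \<noteq> []" "hd w \<noteq> flip (last w)"
  shows "reduced (concat (replicate k w))"
proof (induction k)
  case (Suc k)
  have "hd (concat (replicate k w)) = hd w" if "concat (replicate k w) \<noteq> []"
    using assms(2) that by (cases k) auto
  with Suc assms show ?case
    by (auto simp: reduced_def successively_append_iff)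
qed auto

lemma reduce_append_cong: "reduce u = reduce u' \<Longrightarrow> reduce (p @ u @ q) = reduce (p @ u' @ q)"
  by (metis reduce_append_left reduce_append_right)

lemma reduce_cancel_pair: "reduce (p @ l # flip l # q) = reduce (p @ q)"
proof -
  have "reduce (l # flip l # q) = reduce q"
    using cancel_Cons_flip'[OF reduced_reduce] by (simp add: reduce_def)
  from reduce_append_cong[OF this, of p "[]"] show ?thesis
    by simp
qed

lemma reduce_conjugate_power:
  "reduce (concat (replicate k (l # v @ [flip l]))) = reduce (l # concat (replicate k v) @ [flip l])"
proof (induction k)
  case (Suc k)
  have "reduce (concat (replicate (Suc k) (l # v @ [flip l])))
      = reduce ((l # v @ [flip l]) @ concat (replicate k (l # v @ [flip l])) @ [])"
    by simp
  also have "\<dots> = reduce ((l # v @ [flip l]) @ (l # concat (replicate k v) @ [flip l]) @ [])"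
    by (rule reduce_append_cong) (rule Suc)
  also have "\<dots> = reduce ((l # v) @ flip l # flip (flip l) # concat (replicate k v) @ [flip l])"
    by simp
  also have "\<dots> = reduce (l # concat (replicate (Suc k) v) @ [flip l])"
    unfolding reduce_cancel_pair by simp
  finally show ?case .
qed (use reduce_cancel_pair[of "[]" l "[]"] in \<open>simp add: reduce_def\<close>)

text \<open>Either \<open>w\<close> is cyclically reduced, and its powers are reduced as they stand, or \<open>w\<close> is a conjugate
  \<open>l v l\<inverse>\<close> of a shorter word, whose powers are conjugate to those of \<open>w\<close>.\<close>

lemma reduce_power_neq_Nil:
  assumes "reduced w" "w \<noteq> []" "k > 0"
  shows "reduce (concat (replicate k w)) \<noteq> []"
  using assms
proof (induction w rule: length_induct)
  case (1 w)
  show ?case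
  proof (cases "hd w = flip (last w)")
    case False
    with 1 show ?thesis
      using reduced_power[of w k] by (auto simp: reduce_reduced)
  next
    case True
    obtain l t where w: "w = l # t"
      using 1 by (cases w) auto
    have "t \<noteq> []"
      using True w by (cases l) auto
    then obtain v where t: "t = v @ [flip l]"
      using True w by (metis append_butlast_last_id flip_flip last_ConsR list.sel(1))
    have "v \<noteq> []" "reduced v"
      using 1 w t by (auto simp: reduced_def successively_Cons successively_append_iff)
    then have v: "reduce (concat (replicate k v)) \<noteq> []"
      using 1 w t by auto
    \<comment> \<open>Conjugating back by \<open>l\<close> turns a trivial power of \<open>w\<close> into a trivial power of \<open>v\<close>.\<close>
    show ?thesis
    proof
      let ?c = "concat (replicate k v)"
      assume "reduce (concat (replicate k w)) = []"
      then have "reduce (l # ?c @ [flip l]) = reduce []"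
        by (simp add: w t reduce_conjugate_power) (simp add: reduce_def)
      from reduce_append_cong[OF this, of "[flip l]" "[l]"]
      have "reduce ([flip l] @ (l # ?c @ [flip l]) @ [l]) = reduce ([flip l] @ [] @ [l])" .
      moreover have "reduce ([flip l] @ (l # ?c @ [flip l]) @ [l]) = reduce ?c"
        using reduce_cancel_pair[of "[]" "flip l" "?c @ [flip l, l]"]
          reduce_cancel_pair[of ?c "flip l" "[]"] by simp
      moreover have "reduce ([flip l] @ [] @ [l]) = []"
        by (simp add: reduce_def)
      ultimately show False
        using v by simp
    qed
  qed
qed

lemma torsion_free_free_group: "torsion_free (free_group S)"
  unfolding torsion_free_def
  by (auto simp: carrier_free_group nat_pow_free_group reduce_power_neq_Nil)

section \<open>Words with heights\<close>

fun step :: "('a \<Rightarrow> int) \<Rightarrow> 'a letter \<Rightarrow> int" where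
  "step \<chi> (Pos a) = \<chi> a"
| "step \<chi> (Neg a) = - \<chi> a"

definition height :: "('a \<Rightarrow> int) \<Rightarrow> 'a word \<Rightarrow> int" where
  "height \<chi> w = sum_list (map (step \<chi>) w)"

text \<open>The letter \<open>Pos a\<close> traverses an edge labelled \<open>a\<close> forwards, \<open>Neg a\<close> traverses one backwards. An edge
  is named by its label and the height of its initial vertex, so that the two traversals of the same
  edge are inverse letters; for \<open>Neg a\<close> that vertex is where the step ends.\<close>

fun at_height :: "('a \<Rightarrow> int) \<Rightarrow> int \<Rightarrow> 'a letter \<Rightarrow> ('a \<times> int) letter" where
  "at_height \<chi> n (Pos a) = Pos (a, n)"
| "at_height \<chi> n (Neg a) = Neg (a, n - \<chi> a)"

fun track :: "('a \<Rightarrow> int) \<Rightarrow> int \<Rightarrow> 'a word \<Rightarrow> ('a \<times> int) word" where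
  "track \<chi> n [] = []"
| "track \<chi> n (l # w) = at_height \<chi> n l # track \<chi> (n + step \<chi> l) w"

lemma height_Nil [simp]: "height \<chi> [] = 0"
  by (simp add: height_def)

lemma height_Cons [simp]: "height \<chi> (l # w) = step \<chi> l + height \<chi> w"
  by (simp add: height_def)

lemma height_append [simp]: "height \<chi> (u @ v) = height \<chi> u + height \<chi> v"
  by (simp add: height_def)

lemma step_flip [simp]: "step \<chi> (flip l) = - step \<chi> l"
  by (cases l) auto

lemma height_reduce [simp]: "height \<chi> (reduce w) = height \<chi> w"
proof (induction w)
  case (Cons l w)
  have "height \<chi> (cancel_Cons l v) = step \<chi> l + height \<chi> v" for v
    by (cases v) auto
  with Cons show ?case
    by (simp add: reduce_def)
qed (simp add: reduce_def)

lemma height_power [simp]: "height \<chi> (concat (replicate k w)) = int k * height \<chi> w"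
  by (induction k) (auto simp: algebra_simps)

lemma track_append: "track \<chi> n (u @ v) = track \<chi> n u @ track \<chi> (n + height \<chi> u) v"
  by (induction u arbitrary: n) (auto simp: add.assoc)

lemma at_height_eq_flip:
  "at_height \<chi> (n + step \<chi> l) l' = flip (at_height \<chi> n l) \<longleftrightarrow> l' = flip l"
  by (cases l; cases l') auto

text \<open>A step and its immediate reversal run along the same edge, and this is the only way in which two
  neighbouring letters of a tracked word can cancel. So reduction before and after tracking agree,
  and evaluation of tracked words is well defined on the free group.\<close>

lemma track_reduce: "track \<chi> n (reduce w) = reduce (track \<chi> n w)"
proof (induction w arbitrary: n)
  case (Cons l w)
  have "track \<chi> n (cancel_Cons l v) = cancel_Cons (at_height \<chi> n l) (track \<chi> (n + step \<chi> l) v)" for v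
    by (cases v) (auto simp: at_height_eq_flip)
  with Cons show ?case
    by (simp add: reduce_def)
qed (simp add: reduce_def)

lemma base_track_shift:
  "map base (track \<chi> (n + m) w) = map (\<lambda>(b, j). (b, j + m)) (map base (track \<chi> n w))"
proof (induction w arbitrary: n)
  case (Cons l w)
  have "track \<chi> (n + m + step \<chi> l) w = track \<chi> (n + step \<chi> l + m) w"
    by (simp add: algebra_simps)
  with Cons[of "n + step \<chi> l"] show ?case
    by (cases l) auto
qed simp

lemma eval_word_track: "eval_word G (g \<circ> fst) (track \<chi> n w) = eval_word G g w"
proof (induction w arbitrary: n)
  case (Cons l w)
  then show ?case
    by (cases l) auto
qed simp

text \<open>Evaluation of tracked words is a homomorphism twisted by the shift of heights, which makes it an
  honest homomorphism on the words of weight \<open>0\<close>.\<close>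

lemma eval_word_track_mult:
  assumes "group H" "range f \<subseteq> carrier H"
  shows "eval_word H f (track \<chi> n (u \<otimes>\<^bsub>free_group S\<^esub> v))
    = eval_word H f (track \<chi> n u) \<otimes>\<^bsub>H\<^esub> eval_word H f (track \<chi> (n + height \<chi> u) v)"
  using assms by (simp add: track_reduce group.eval_word_reduce track_append group.eval_word_append)

lemma eval_word_track_power:
  assumes "group H" "range f \<subseteq> carrier H" "height \<chi> w = 0"
  shows "eval_word H f (track \<chi> n (w [^]\<^bsub>free_group S\<^esub> (k :: nat)))
    = eval_word H f (track \<chi> n w) [^]\<^bsub>H\<^esub> k"
proof (induction k)
  case (Suc k)
  have "height \<chi> (w [^]\<^bsub>free_group S\<^esub> k) = 0"
    by (simp add: nat_pow_free_group assms)
  with Suc eval_word_track_mult[OF assms(1,2), of \<chi> n S "w [^]\<^bsub>free_group S\<^esub> k" w]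
  show ?case
    by simp
qed simp

lemma height_inv_free_group:
  assumes "u \<in> carrier (free_group S)"
  shows "height \<chi> (inv\<^bsub>free_group S\<^esub> u) = - height \<chi> u"
proof -
  have "inv\<^bsub>free_group S\<^esub> u \<otimes>\<^bsub>free_group S\<^esub> u = []"
    using group.l_inv[OF group_free_group assms] by simp
  then have "height \<chi> (reduce (inv\<^bsub>free_group S\<^esub> u @ u)) = 0"
    by simp
  then show ?thesis
    by simp
qed

text \<open>The relator can only be made to take the right value at large heights. Demanding membership in
  \<open>K\<close> only eventually keeps the subgroup normal: conjugation by \<open>x\<close> conjugates the values in \<open>H\<close> and
  shifts the heights by the fixed amount \<open>height \<chi> x\<close>.\<close>

lemma normal_track_preimage:
  assumes K: "K \<lhd> H" and f: "range f \<subseteq> carrier H"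
  shows "{u \<in> carrier (free_group S). height \<chi> u = 0 \<and>
      (\<forall>\<^sub>F n in at_top. eval_word H f (track \<chi> n u) \<in> K)} \<lhd> free_group S"
    (is "?L \<lhd> ?F")
proof -
  interpret F: group ?F
    by (rule group_free_group)
  interpret K: normal K H
    by (rule K)
  define E where "E n u = eval_word H f (track \<chi> n u)" for n u
  have E_closed: "E n u \<in> carrier H" for n u
    using f by (simp add: E_def)
  have E_mult: "E n (u \<otimes>\<^bsub>?F\<^esub> v) = E n u \<otimes>\<^bsub>H\<^esub> E (n + height \<chi> u) v" for n u v
    unfolding E_def using K.is_group f by (rule eval_word_track_mult)
  have E_one: "E n \<one>\<^bsub>?F\<^esub> = \<one>\<^bsub>H\<^esub>" for n
    by (simp add: E_def)
  have E_inv: "E (n + height \<chi> u) (inv\<^bsub>?F\<^esub> u) = inv\<^bsub>H\<^esub> (E n u)"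
    if "u \<in> carrier ?F" for n u
  proof -
    have "E n u \<otimes>\<^bsub>H\<^esub> E (n + height \<chi> u) (inv\<^bsub>?F\<^esub> u) = \<one>\<^bsub>H\<^esub>"
      using that E_mult[of n u "inv\<^bsub>?F\<^esub> u"] E_one by (simp del: mult_free_group one_free_group)
    then show ?thesis
      by (metis E_closed K.inv_equality K.inv_inv)
  qed
  have height_mult: "height \<chi> (u \<otimes>\<^bsub>?F\<^esub> v) = height \<chi> u + height \<chi> v" for u v
    by simp
  let ?M = "{u \<in> carrier ?F. height \<chi> u = 0 \<and> (\<forall>\<^sub>F n in at_top. E n u \<in> K)}"
  show ?thesis
    unfolding F.normal_inv_iff E_def[symmetric]
  proof (intro conjI ballI F.subgroupI)
    show "?M \<subseteq> carrier ?F"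
      by blast
  next
    have "height \<chi> \<one>\<^bsub>?F\<^esub> = 0"
      by simp
    then have "\<one>\<^bsub>?F\<^esub> \<in> ?M"
      using subgroup.one_closed[OF K.subgroup_axioms] E_one by (simp del: one_free_group)
    then show "?M \<noteq> {}"
      by blast
  next
    fix u assume u: "u \<in> ?M"
    have "\<forall>\<^sub>F n in at_top. E n (inv\<^bsub>?F\<^esub> u) \<in> K"
      using u E_inv[of u] by (auto elim!: eventually_mono)
    with u show "inv\<^bsub>?F\<^esub> u \<in> ?M"
      by (simp add: height_inv_free_group)
    fix v assume v: "v \<in> ?M"
    have "\<forall>\<^sub>F n in at_top. E n u \<in> K" "\<forall>\<^sub>F n in at_top. E n v \<in> K"
      using u v by auto
    then have "\<forall>\<^sub>F n in at_top. E n (u \<otimes>\<^bsub>?F\<^esub> v) \<in> K"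
      by eventually_elim (use u in \<open>simp add: E_mult del: mult_free_group\<close>)
    with u v show "u \<otimes>\<^bsub>?F\<^esub> v \<in> ?M"
      using height_mult by (simp del: mult_free_group)
  next
    fix x u assume x: "x \<in> carrier ?F"
      and u: "u \<in> ?M"
    from u obtain m where m: "E n u \<in> K" if "n \<ge> m" for n
      by (auto simp: eventually_at_top_linorder)
    have "E n (x \<otimes>\<^bsub>?F\<^esub> u \<otimes>\<^bsub>?F\<^esub> inv\<^bsub>?F\<^esub> x) \<in> K" if "n \<ge> m - height \<chi> x" for n
    proof -
      have "E n (x \<otimes>\<^bsub>?F\<^esub> u \<otimes>\<^bsub>?F\<^esub> inv\<^bsub>?F\<^esub> x)
          = E n x \<otimes>\<^bsub>H\<^esub> E (n + height \<chi> x) u \<otimes>\<^bsub>H\<^esub> inv\<^bsub>H\<^esub> (E n x)"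
        using u x by (simp add: E_mult height_mult E_inv del: mult_free_group)
      then show ?thesis
        using K.inv_op_closed2[OF E_closed m] that by simp
    qed
    then have "\<forall>\<^sub>F n in at_top. E n (x \<otimes>\<^bsub>?F\<^esub> u \<otimes>\<^bsub>?F\<^esub> inv\<^bsub>?F\<^esub> x) \<in> K"
      unfolding eventually_at_top_linorder by blast
    with x u show "x \<otimes>\<^bsub>?F\<^esub> u \<otimes>\<^bsub>?F\<^esub> inv\<^bsub>?F\<^esub> x \<in> ?M"
      using height_mult by (simp add: height_inv_free_group del: mult_free_group)
  qed
qed

section \<open>Solving the relator at its peak\<close>

text \<open>Here \<open>h\<close> is the greatest height of an edge labelled \<open>a\<close>: listing the edges labelled \<open>a\<close> at height
  \<open>h\<close> or above, with multiplicity, must give a single entry. Other labels may occur higher up. The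
  filter makes the property decidable by rewriting for a concrete word.\<close>

definition unique_peak :: "('a \<Rightarrow> int) \<Rightarrow> 'a \<Rightarrow> int \<Rightarrow> 'a word \<Rightarrow> bool" where
  "unique_peak \<chi> a h r \<longleftrightarrow>
    filter (\<lambda>(b, j). b = a \<and> h \<le> j) (map base (track \<chi> 0 r)) = [(a, h)]"

lemma unique_peak_track:
  assumes "unique_peak \<chi> a h r"
  obtains u l v where "track \<chi> n r = u @ l # v" "base l = (a, h + n)"
    "\<And>j. (a, j) \<in> base ` set (u @ v) \<Longrightarrow> j < h + n"
proof -
  let ?P = "\<lambda>(b, j). b = a \<and> h + n \<le> j"
  have "filter ?P (map (\<lambda>(b, j). (b, j + n)) ps)
      = map (\<lambda>(b, j). (b, j + n)) (filter (\<lambda>(b, j). b = a \<and> h \<le> j) ps)" for ps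
    by (induction ps) auto
  then have "filter ?P (map base (track \<chi> n r)) = [(a, h + n)]"
    using assms base_track_shift[of \<chi> 0 n r] by (simp add: unique_peak_def del: map_map)
  then have "\<exists>l. filter (?P \<circ> base) (track \<chi> n r) = [l] \<and> base l = (a, h + n)"
    by (auto simp: filter_map)
  then obtain l u v where "track \<chi> n r = u @ l # v" "base l = (a, h + n)"
    "\<forall>x\<in>set u. \<not> ?P (base x)" "filter (?P \<circ> base) v = []"
    by (auto simp: filter_eq_Cons_iff)
  moreover from this have "j < h + n" if "(a, j) \<in> base ` set (u @ v)" for j
    using that by (fastforce simp: filter_empty_conv)
  ultimately show ?thesis
    using that by blast
qed

text \<open>Well-founded recursion on the height \<open>j\<close> of the letters \<open>(a, j)\<close>. For \<open>j < 0\<close> the value is the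
  prescribed one; for \<open>j \<ge> 0\<close> it is the solution of the equation for the copy of \<open>r\<close> that peaks at
  height \<open>j\<close>, the one read from height \<open>j - h\<close>. The recursion needs a bottom, and therefore the
  equations hold only from height \<open>- h\<close> on.\<close>

lemma relator_solvable:
  fixes H :: "('g, 'm) monoid_scheme"
  assumes "group H" and peak: "unique_peak \<chi> a h r" and g: "range g \<subseteq> carrier H" and c: "c \<in> carrier H"
  obtains f where "range f \<subseteq> carrier H" "\<And>b j. b \<noteq> a \<or> j < 0 \<Longrightarrow> f (b, j) = g (b, j)"
    "\<And>n. 0 \<le> h + n \<Longrightarrow> eval_word H f (track \<chi> n r) = c"
proof -
  interpret group H by fact
  define F where "F A = (\<lambda>(b, j). if b = a then A j else g (b, j))" for A :: "int \<Rightarrow> 'g"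
  define P where "P A j y \<longleftrightarrow> y \<in> carrier H \<and>
    (if j < 0 then y = g (a, j) else eval_word H (F (A(j := y))) (track \<chi> (j - h) r) = c)"
    for A j y
  define R where "R = {(i, j :: int). 0 \<le> j \<and> i < j}"
  have "wf R"
    by (rule wf_subset[OF wf_measure[of "\<lambda>j. nat (j + 1)"]]) (auto simp: R_def)
  \<comment> \<open>All letters \<open>(a, i)\<close> in the copy of \<open>r\<close> peaking at \<open>j\<close>, except the peak, have \<open>i < j\<close>.\<close>
  moreover have P_local: "P A j y = P A' j y" if "\<And>i. (i, j) \<in> R \<Longrightarrow> A i = A' i" for A A' j y
  proof (cases "j < 0")
    case False
    obtain u l v where d: "track \<chi> (j - h) r = u @ l # v" "base l = (a, h + (j - h))"
      "\<And>i. (a, i) \<in> base ` set (u @ v) \<Longrightarrow> i < h + (j - h)"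
      using unique_peak_track[OF peak] by metis
    have "F (A(j := y)) p = F (A'(j := y)) p" if "p \<in> base ` set (track \<chi> (j - h) r)" for p
    proof -
      obtain b i where p: "p = (b, i)"
        by (cases p)
      have "b = a \<Longrightarrow> i \<noteq> j \<Longrightarrow> i < j"
        using that d by (auto simp: p)
      then show ?thesis
        using False \<open>\<And>i. (i, j) \<in> R \<Longrightarrow> A i = A' i\<close> by (auto simp: F_def R_def p)
    qed
    then have "eval_word H (F (A(j := y))) (track \<chi> (j - h) r)
        = eval_word H (F (A'(j := y))) (track \<chi> (j - h) r)"
      by (rule eval_word_cong)
    then show ?thesis
      by (simp add: P_def)
  qed (simp add: P_def)
  moreover have "\<exists>y. P A j y" if A: "\<And>i. (i, j) \<in> R \<Longrightarrow> P A i (A i)" for A j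
  proof (cases "j < 0")
    case False
    \<comment> \<open>Only the values of \<open>A\<close> below \<open>j\<close> are known to lie in \<open>H\<close>; the others are replaced by \<open>\<one>\<close>.\<close>
    define A' where "A' i = (if i < j then A i else \<one>\<^bsub>H\<^esub>)" for i
    obtain u l v where d: "track \<chi> (j - h) r = u @ l # v" "base l = (a, h + (j - h))"
      "\<And>i. (a, i) \<in> base ` set (u @ v) \<Longrightarrow> i < h + (j - h)"
      using unique_peak_track[OF peak] by metis
    have "A' i \<in> carrier H" for i
      using A[of i] False by (auto simp: A'_def R_def P_def)
    then have "range (F A') \<subseteq> carrier H"
      using g by (auto simp: F_def)
    moreover have "base l \<notin> base ` set (u @ v)"
      using d(2) d(3)[of j] by auto
    ultimately obtain y where y: "y \<in> carrier H" "eval_word H ((F A')(base l := y)) (u @ l # v) = c"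
      using eval_word_solvable c by metis
    have "(F A')(base l := y) = F (A'(j := y))"
      using d(2) by (auto simp: F_def)
    with y d False have "P A' j y"
      by (simp add: P_def)
    moreover have "P A' j y = P A j y"
      by (rule P_local) (simp add: A'_def R_def)
    ultimately show ?thesis
      by blast
  next
    case True
    then show ?thesis
      using g by (auto simp: P_def)
  qed
  ultimately have "\<exists>A. \<forall>j. P A j (A j)"
    by (rule dependent_wf_choice)
  then obtain A where A: "P A j (A j)" for j
    by blast
  show ?thesis
  proof
    show "range (F A) \<subseteq> carrier H"
      using A g by (auto simp: F_def P_def)
    show "F A (b, j) = g (b, j)" if "b \<noteq> a \<or> j < 0" for b j
      using that A[of j] by (auto simp: F_def P_def)
    show "eval_word H (F A) (track \<chi> n r) = c" if "0 \<le> h + n" for n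
      using that A[of "h + n"] by (simp add: P_def)
  qed
qed

section \<open>One-relator presentations with a unique peak\<close>

lemma normal_closure_subset: "N \<lhd> G \<Longrightarrow> R \<subseteq> N \<Longrightarrow> normal_closure G R \<subseteq> N"
  by (auto simp: normal_closure_def)

lemma subset_normal_closure: "R \<subseteq> normal_closure G R"
  by (auto simp: normal_closure_def)

text \<open>The default \<open>[]\<close> outside \<open>S\<close> is the identity; it makes the assignment total with values in the free
  group.\<close>

lemma eval_word_generators:
  assumes "w \<in> carrier (free_group S)"
  shows "eval_word (free_group S) (\<lambda>b. if b \<in> S then [Pos b] else []) w = w"
  using assms
proof (induction w)
  case (Cons l w)
  interpret group "free_group S"
    by (rule group_free_group)
  have "inv\<^bsub>free_group S\<^esub> [Pos b] = [Neg b]" if "b \<in> S" for b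
    using that by (intro inv_equality) (auto simp: carrier_free_group reduce_def reduced_def)
  then have "eval_letter (free_group S) (\<lambda>b. if b \<in> S then [Pos b] else []) l = [l]"
    using Cons.prems by (cases l) (auto simp: carrier_free_group)
  moreover have "w \<in> carrier (free_group S)"
    using Cons.prems by (auto simp: carrier_free_group dest: reduced_ConsD)
  ultimately show ?case
    using Cons by (simp add: reduce_reduced carrier_free_group)
qed simp

lemma factor_group_nat_pow_eq_one_iff:
  assumes "N \<lhd> G" "u \<in> carrier G"
  shows "(N #>\<^bsub>G\<^esub> u) [^]\<^bsub>G Mod N\<^esub> (k :: nat) = \<one>\<^bsub>G Mod N\<^esub> \<longleftrightarrow> u [^]\<^bsub>G\<^esub> k \<in> N"
proof -
  interpret normal N G by fact
  have "u [^]\<^bsub>G\<^esub> k \<in> carrier G"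
    using assms by simp
  then show ?thesis
    using assms(2) FactGroup_pow[of u k] rcos_self[OF _ is_subgroup, of "u [^]\<^bsub>G\<^esub> k"]
      rcos_const[OF is_group, of "u [^]\<^bsub>G\<^esub> k"]
    by auto
qed

lemma factor_group_eq_one_iff:
  assumes "N \<lhd> G" "u \<in> carrier G"
  shows "N #>\<^bsub>G\<^esub> u = \<one>\<^bsub>G Mod N\<^esub> \<longleftrightarrow> u \<in> N"
proof -
  interpret normal N G by fact
  show ?thesis
    using assms(2) rcos_self[OF _ is_subgroup, of u] rcos_const[OF is_group, of u] by auto
qed

text \<open>In the proof, \<open>\<eta>\<close> forgets heights. It maps the value \<open>f p\<close> of every letter \<open>p = (b, j)\<close> to the class
  of \<open>b\<close>: for the letters solved for, because both sides satisfy the same relator equation, whose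
  lower letters agree by induction. So \<open>\<eta>\<close> recovers the class of a word from its value at any single
  height, while the values of words in \<open>N\<close> are eventually trivial.\<close>

theorem torsion_free_unique_peak:
  assumes r: "r \<in> carrier (free_group S)" "height \<chi> r = 0" "unique_peak \<chi> a h r"
  shows "torsion_free (presented_group (Presentation S {r}))"
proof -
  define F where "F = free_group S"
  define N where "N = normal_closure F {r}"
  define G where "G = F Mod N"
  define FF where "FF = free_group (UNIV :: ('a \<times> int) set)"
  interpret F: group F
    unfolding F_def by (rule group_free_group)
  interpret FF: group FF
    unfolding FF_def by (rule group_free_group)
  have N: "N \<lhd> F"
    unfolding N_def using r by (intro normal_normal_closure F.is_group) (simp add: F_def)
  interpret N: normal N F
    by (rule N)
  interpret G: group G
    unfolding G_def by (rule N.factorgroup_is_group)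
  define gen where "gen b = (if b \<in> S then [Pos b] else [])" for b
  define c where "c = (\<lambda>w. N #>\<^bsub>F\<^esub> w) \<circ> gen"
  have gen: "range gen \<subseteq> carrier F"
    by (auto simp: gen_def F_def carrier_free_group reduced_def)
  have quot: "(\<lambda>w. N #>\<^bsub>F\<^esub> w) \<in> hom F G"
    unfolding G_def by (rule N.r_coset_hom_Mod)
  have c: "range c \<subseteq> carrier G"
    using gen hom_in_carrier[OF quot] by (auto simp: c_def)
  have coset: "N #>\<^bsub>F\<^esub> w = eval_word G c w" if "w \<in> carrier F" for w
  proof -
    have "eval_word F gen w = w"
      using eval_word_generators that by (simp add: F_def gen_def[abs_def])
    then show ?thesis
      using eval_word_compose[OF F.is_group G.is_group quot gen, of w] by (simp add: c_def)
  qed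
  obtain f where f: "range f \<subseteq> carrier FF"
    and f_gen: "\<And>b j. b \<noteq> a \<or> j < 0 \<Longrightarrow> f (b, j) = [Pos (b, j)]"
    and f_r: "\<And>n. 0 \<le> h + n \<Longrightarrow> eval_word FF f (track \<chi> n r) = []"
  proof (rule relator_solvable[OF FF.is_group r(3), of "\<lambda>p. [Pos p]" "[]"])
    show "range (\<lambda>p. [Pos p]) \<subseteq> carrier FF" "[] \<in> carrier FF"
      by (auto simp: FF_def carrier_free_group reduced_def)
  qed blast
  define \<eta> where "\<eta> = eval_word G (c \<circ> (fst :: 'a \<times> int \<Rightarrow> 'a))"
  have \<eta>: "\<eta> \<in> hom FF G"
    unfolding \<eta>_def FF_def using c by (intro G.eval_word_hom) auto
  have \<eta>_one: "\<eta> [] = \<one>\<^bsub>G\<^esub>"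
    by (simp add: \<eta>_def)
  have \<eta>_f_range: "range (\<eta> \<circ> f) \<subseteq> carrier G"
    using f hom_in_carrier[OF \<eta>] by auto
  have \<eta>_eval: "\<eta> (eval_word FF f w) = eval_word G (\<eta> \<circ> f) w" for w
    by (rule eval_word_compose) (use f \<eta> in \<open>auto intro: FF.is_group G.is_group\<close>)
  have \<eta>_gen: "(\<eta> \<circ> f) (b, j) = (c \<circ> fst) (b, j)" if "b \<noteq> a \<or> j < 0" for b j
    using c by (auto simp: f_gen[OF that] \<eta>_def image_subset_iff)
  \<comment> \<open>The measure \<open>nat (j + 1)\<close> is \<open>0\<close> exactly for the heights at which \<open>f\<close> was prescribed.\<close>
  have \<eta>_a: "(\<eta> \<circ> f) (a, j) = (c \<circ> fst) (a, j)" for j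
  proof (induction "nat (j + 1)" arbitrary: j rule: less_induct)
    case less
    show ?case
    proof (cases "j < 0")
      case False
      obtain u l v where d: "track \<chi> (j - h) r = u @ l # v" "base l = (a, h + (j - h))"
        "\<And>i. (a, i) \<in> base ` set (u @ v) \<Longrightarrow> i < h + (j - h)"
        using unique_peak_track[OF r(3)] by metis
      have "(\<eta> \<circ> f) (b, i) = (c \<circ> fst) (b, i)" if "(b, i) \<in> base ` set (u @ v)" for b i
      proof (cases "b = a")
        case True
        then have "i < j"
          using d(3)[of i] that by simp
        then have "nat (i + 1) < nat (j + 1)"
          using False by simp
        from less[OF this] True show ?thesis
          by simp
      qed (use \<eta>_gen in blast)
      then have agree: "(\<eta> \<circ> f) p = (c \<circ> fst) p" if "p \<in> base ` set (u @ v)" for p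
        using that by (metis surj_pair)
      have eq: "eval_word G (\<eta> \<circ> f) (u @ l # v) = eval_word G (c \<circ> fst) (u @ l # v)"
      proof -
        have "eval_word G (\<eta> \<circ> f) (u @ l # v) = \<one>\<^bsub>G\<^esub>"
          using \<eta>_eval[of "u @ l # v"] f_r[of "j - h"] d(1) False \<eta>_one by simp
        also have "\<dots> = N #>\<^bsub>F\<^esub> r"
          using factor_group_eq_one_iff[OF N, of r] subset_normal_closure[of "{r}" F] r(1)
          by (simp add: N_def F_def G_def)
        also have "\<dots> = eval_word G (c \<circ> fst) (u @ l # v)"
          using coset[of r] r(1) eval_word_track[of G c \<chi> "j - h" r] d(1) by (simp add: F_def)
        finally show ?thesis .
      qed
      have "range (c \<circ> fst) \<subseteq> carrier G"
        using c by auto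
      then have "(\<eta> \<circ> f) (base l) = (c \<circ> fst) (base l)"
        using agree eq by (rule G.eval_word_solution_unique[OF \<eta>_f_range])
      then show ?thesis
        using d(2) by simp
    qed (use \<eta>_gen in blast)
  qed
  have "(\<eta> \<circ> f) (b, j) = (c \<circ> fst) (b, j)" for b j
    using \<eta>_a[of j] \<eta>_gen[of b j] by (cases "b = a") simp_all
  then have \<eta>_f: "\<eta> \<circ> f = c \<circ> fst"
    by (intro ext) (metis surj_pair)
  define L where "L = {u \<in> carrier F. height \<chi> u = 0 \<and>
    (\<forall>\<^sub>F n in at_top. eval_word FF f (track \<chi> n u) \<in> {\<one>\<^bsub>FF\<^esub>})}"
  have "L \<lhd> F"
    unfolding L_def F_def by (rule normal_track_preimage[OF FF.one_is_normal f])
  moreover have "r \<in> L"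
  proof -
    have "\<forall>n\<ge>-h. eval_word FF f (track \<chi> n r) \<in> {\<one>\<^bsub>FF\<^esub>}"
      using f_r by (simp add: FF_def)
    then show ?thesis
      using r(1,2) unfolding L_def F_def eventually_at_top_linorder by blast
  qed
  ultimately have N_L: "N \<subseteq> L"
    unfolding N_def by (intro normal_closure_subset) auto
  have "N #>\<^bsub>F\<^esub> u = \<one>\<^bsub>G\<^esub>" if u: "u \<in> carrier F" and k: "k > 0" "u [^]\<^bsub>F\<^esub> k \<in> N" for u and k :: nat
  proof -
    from k N_L have uk: "u [^]\<^bsub>F\<^esub> k \<in> L"
      by blast
    then have u0: "height \<chi> u = 0"
      using k(1) by (simp add: L_def F_def nat_pow_free_group)
    from uk obtain n where "eval_word FF f (track \<chi> n (u [^]\<^bsub>F\<^esub> k)) = \<one>\<^bsub>FF\<^esub>"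
      by (auto simp: L_def eventually_at_top_linorder)
    then have "eval_word FF f (track \<chi> n u) [^]\<^bsub>FF\<^esub> k = \<one>\<^bsub>FF\<^esub>"
      using eval_word_track_power[OF FF.is_group f u0] by (simp add: F_def)
    moreover have "eval_word FF f (track \<chi> n u) \<in> carrier FF"
      using f by simp
    ultimately have "eval_word FF f (track \<chi> n u) = \<one>\<^bsub>FF\<^esub>"
      using torsion_free_free_group[of "UNIV :: ('a \<times> int) set"] k(1)
      unfolding torsion_free_def FF_def[symmetric] by blast
    then have "eval_word G (c \<circ> fst) (track \<chi> n u) = \<one>\<^bsub>G\<^esub>"
      using \<eta>_eval[of "track \<chi> n u"] \<eta>_f \<eta>_one by (simp add: FF_def)
    then show ?thesis
      using coset[OF u] by (simp add: eval_word_track)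
  qed
  then have no_torsion: "N #>\<^bsub>F\<^esub> u = \<one>\<^bsub>G\<^esub>"
    if "u \<in> carrier F" "k > 0" "(N #>\<^bsub>F\<^esub> u) [^]\<^bsub>G\<^esub> k = \<one>\<^bsub>G\<^esub>" for u and k :: nat
    using that factor_group_nat_pow_eq_one_iff[OF N] unfolding G_def by blast
  have "presented_group (Presentation S {r}) = G"
    by (simp add: presented_group_def G_def F_def N_def)
  moreover have "torsion_free G"
    unfolding torsion_free_def
  proof (intro notI, elim bexE conjE exE)
    fix g and k :: nat
    assume g: "g \<in> carrier G" "g \<noteq> \<one>\<^bsub>G\<^esub>" "k > 0" "g [^]\<^bsub>G\<^esub> k = \<one>\<^bsub>G\<^esub>"
    then obtain u where "u \<in> carrier F" "g = N #>\<^bsub>F\<^esub> u"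
      by (auto simp: G_def carrier_FactGroup)
    with g no_torsion show False
      by blast
  qed
  ultimately show ?thesis
    by simp
qed

lemma nat_pow_integer_group: "x [^]\<^bsub>integer_group\<^esub> (k :: nat) = int k * x"
  by (induction k) (auto simp: algebra_simps)

text \<open>With values in \<open>\<int>\<close>, the copies of \<open>r\<close> at large heights can all be given the value \<open>1\<close>, even when \<open>r\<close>
  is trivial in the abelianization modulo \<open>k\<close>, as it is for \<open>x\<^sup>2y\<^sup>2z\<^sup>2xzy\<close> and \<open>k = 3\<close>. This separates \<open>r\<close>
  from the normal closure of \<open>r\<^sup>k\<close>.\<close>

theorem not_torsion_free_unique_peak_power:
  assumes r: "r \<in> carrier (free_group S)" "height \<chi> r = 0" "unique_peak \<chi> a h r" and k: "k \<ge> 2"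
  shows "\<not> torsion_free (presented_group (Presentation S {r [^]\<^bsub>free_group S\<^esub> (k :: nat)}))"
proof -
  define F where "F = free_group S"
  define N where "N = normal_closure F {r [^]\<^bsub>F\<^esub> k}"
  interpret F: group F
    unfolding F_def by (rule group_free_group)
  have rF: "r \<in> carrier F" "r [^]\<^bsub>F\<^esub> k \<in> carrier F"
    using r F.nat_pow_closed by (auto simp: F_def)
  have N: "N \<lhd> F"
    unfolding N_def using rF by (intro normal_normal_closure F.is_group) simp
  obtain f :: "'a \<times> int \<Rightarrow> int" where
    f: "\<And>n. 0 \<le> h + n \<Longrightarrow> eval_word integer_group f (track \<chi> n r) = 1"
    by (rule relator_solvable[OF group_integer_group r(3), of "\<lambda>_. 0" 1]) auto
  define K where "K = {i. int k dvd i}"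
  interpret Z: comm_group integer_group
    by (rule abelian_integer_group)
  have "subgroup K integer_group"
    by (rule Z.subgroupI) (auto simp: K_def)
  then have K: "K \<lhd> integer_group"
    by (rule Z.subgroup_imp_normal)
  define L where "L = {u \<in> carrier F. height \<chi> u = 0 \<and>
    (\<forall>\<^sub>F n in at_top. eval_word integer_group f (track \<chi> n u) \<in> K)}"
  have "L \<lhd> F"
    unfolding L_def F_def by (rule normal_track_preimage[OF K]) simp
  moreover have "r [^]\<^bsub>F\<^esub> k \<in> L"
  proof -
    have "height \<chi> (r [^]\<^bsub>F\<^esub> k) = 0"
      using r(2) by (simp add: F_def nat_pow_free_group)
    moreover have "eval_word integer_group f (track \<chi> n (r [^]\<^bsub>F\<^esub> k)) \<in> K" if "n \<ge> - h" for n
      using that f eval_word_track_power[of integer_group f \<chi> r n S k] r(2)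
      by (simp add: F_def K_def nat_pow_integer_group)
    ultimately show ?thesis
      using rF by (auto simp: L_def eventually_at_top_linorder)
  qed
  ultimately have "N \<subseteq> L"
    unfolding N_def by (intro normal_closure_subset) auto
  moreover have "r \<notin> L"
  proof
    assume "r \<in> L"
    then obtain m where m: "eval_word integer_group f (track \<chi> n r) \<in> K" if "n \<ge> m" for n
      by (auto simp: L_def eventually_at_top_linorder)
    have "1 \<in> K"
      using m[of "max m (- h)"] f[of "max m (- h)"] by simp
    then show False
      using k by (simp add: K_def)
  qed
  ultimately have "r \<notin> N"
    by blast
  moreover have "r [^]\<^bsub>F\<^esub> k \<in> N"
    using subset_normal_closure[of "{r [^]\<^bsub>F\<^esub> k}" F] by (simp add: N_def)
  ultimately have "N #>\<^bsub>F\<^esub> r \<noteq> \<one>\<^bsub>F Mod N\<^esub>" "(N #>\<^bsub>F\<^esub> r) [^]\<^bsub>F Mod N\<^esub> k = \<one>\<^bsub>F Mod N\<^esub>"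
    using factor_group_eq_one_iff[OF N rF(1)] factor_group_nat_pow_eq_one_iff[OF N rF(1)] by auto
  moreover have "N #>\<^bsub>F\<^esub> r \<in> carrier (F Mod N)"
    using rF(1) by (auto simp: carrier_FactGroup)
  moreover have "k > 0"
    using k by simp
  moreover have "presented_group (Presentation S {r [^]\<^bsub>free_group S\<^esub> k}) = F Mod N"
    by (simp add: presented_group_def F_def N_def)
  ultimately show ?thesis
    unfolding torsion_free_def by metis
qed

section \<open>The twelve words\<close>

fun weight :: "int \<Rightarrow> int \<Rightarrow> int \<Rightarrow> xyz \<Rightarrow> int" where
  "weight i j k GenX = i"
| "weight i j k GenY = j"
| "weight i j k GenZ = k"

text \<open>In the order of the list of words, the weights \<open>(1, -1, 0)\<close> with peak label \<open>y\<close> serve the words 1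
  and 5, the weights \<open>(0, 1, -1)\<close> with peak label \<open>z\<close> the words 7, 10 and 11, and the weights
  \<open>(1, 0, -1)\<close> with peak label \<open>y\<close> all others.\<close>

lemma twelve_words_unique_peak:
  assumes "r \<in> twelve_words"
  shows "\<exists>\<chi> a h. height \<chi> r = 0 \<and> unique_peak \<chi> a h r"
proof -
  have "(height (weight 1 (-1) 0) r = 0 \<and> unique_peak (weight 1 (-1) 0) GenY 2 r)
      \<or> (\<exists>h\<in>{2, 3}. height (weight 1 0 (-1)) r = 0 \<and> unique_peak (weight 1 0 (-1)) GenY h r)
      \<or> (\<exists>h\<in>{0, 1, 2}. height (weight 0 1 (-1)) r = 0 \<and> unique_peak (weight 0 1 (-1)) GenZ h r)"
    using assms unfolding twelve_words_def Let_def unique_peak_def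
    by (elim insertE emptyE; hypsubst; simp)
  then show ?thesis
    by blast
qed

lemma power_presentation_torsion_free_iff:
  assumes r: "r \<in> twelve_words" and "n \<ge> 1"
  shows "defines_torsion_free_group (power_presentation r n) \<longleftrightarrow> n = 1"
proof -
  let ?F = "free_group {GenX, GenY, GenZ}"
  obtain \<chi> a h where peak: "height \<chi> r = 0" "unique_peak \<chi> a h r"
    using twelve_words_unique_peak[OF r] by blast
  have rF: "r \<in> carrier ?F"
    using r twelve_words_carrier by blast
  have "r [^]\<^bsub>?F\<^esub> (1 :: nat) = r"
    using rF by (simp add: nat_pow_free_group carrier_free_group reduce_reduced)
  then have "n = 1 \<Longrightarrow> ?thesis"
    using torsion_free_unique_peak[OF rF peak]
    by (simp add: defines_torsion_free_group_def power_presentation_def)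
  moreover have "n \<ge> 2 \<Longrightarrow> ?thesis"
    using not_torsion_free_unique_peak_power[OF rF peak]
    by (simp add: defines_torsion_free_group_def power_presentation_def)
  ultimately show ?thesis
    using \<open>n \<ge> 1\<close> by linarith
qed

theorem corollary4:
  shows "(\<forall>r\<in>twelve_words. \<forall>n\<ge>1.
            defines_torsion_free_group (power_presentation r n) \<longleftrightarrow> n = 1)
       \<and> card {P. (\<exists>r\<in>twelve_words. \<exists>n\<ge>1. P = power_presentation r n)
                  \<and> defines_torsion_free_group P} = 12"
proof
  have "{P. (\<exists>r\<in>twelve_words. \<exists>n\<ge>1. P = power_presentation r n) \<and> defines_torsion_free_group P}
      = (\<lambda>r. power_presentation r 1) ` twelve_words"
    using power_presentation_torsion_free_iff by fastforce
  moreover have "power_presentation r 1 = Presentation {GenX, GenY, GenZ} {r}"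
    if "r \<in> twelve_words" for r
    using that twelve_words_carrier
    by (auto simp: power_presentation_def nat_pow_free_group carrier_free_group reduce_reduced)
  then have "inj_on (\<lambda>r. power_presentation r 1) twelve_words"
    by (auto intro!: inj_onI)
  moreover have "card twelve_words = 12"
    by (simp add: twelve_words_def Let_def)
  ultimately show "card {P. (\<exists>r\<in>twelve_words. \<exists>n\<ge>1. P = power_presentation r n)
      \<and> defines_torsion_free_group P} = 12"
    by (simp add: card_image)
qed (use power_presentation_torsion_free_iff in blast)

end
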